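(* Let $1\leq k\leq n$ be integers. Let $\mathcal{R}(2n-k-1,n-k)$ be the set of partial matchings of $[2n-k-1]$ with exactly $n-k$ arcs, no neighbor alignments, no left nestings and no right nestings, and let $\mathcal{C}\left(n-k,\binom{k+1}{2}\right)$ be the set of compositions of $n-k$ into $\binom{k+1}{2}$ (possibly empty) components. Then there is a bijection between $\mathcal{R}(2n-k-1,n-k)$ and $\mathcal{C}\left(n-k,\binom{k+1}{2}\right)$.
   Context: Write $[m]=\{1,2,\ldots,m\}$, with $[0]=\emptyset$ (which has exactly one partial matching, the empty one, with $0$ arcs). A partition $\pi$ of $[m]$ (set partition into nonempty blocks) is represented by a diagram with vertices $1,\ldots,m$: for each block $B=\{i_1<i_2<\cdots<i_r\}$ one draws the arcs $(i_1,i_2),(i_2,i_3),\ldots,(i_{r-1},i_r)$. A partial matching of $[m]$ is a partition of $[m]$ in which each block has at most two elements; its arcs are the pairs $(i,j)$, $i<j$, such that $\{i,j\}$ is a block. A neighbor alignment is a pair of arcs $(i_1,j_1),(i_2,j_2)$ with $i_1<j_1<i_2<j_2$ and $j_1+1=i_2$. A nesting is a pair of arcs $(i_1,j_1),(i_2,j_2)$ with $i_1<i_2<j_2<j_1$; it is a left nesting if $i_1+1=i_2$ and a right nesting if $j_2+1=j_1$. A composition of $a$ into $b$ (possibly empty) components is a sequence $(c_1,\ldots,c_b)$ of nonnegative integers with $c_1+\cdots+c_b=a$. *)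

theory Defs
  imports Main "HOL-Library.Disjoint_Sets"
begin

definition partial_matching :: "nat \<Rightarrow> nat set set \<Rightarrow> bool" where
  "partial_matching m P \<longleftrightarrow> partition_on {1..m} P \<and> (\<forall>B\<in>P. card B \<le> 2)"

(* On partial matchings these are exactly the arcs between consecutive elements of a block. *)
definition arcs :: "nat set set \<Rightarrow> (nat \<times> nat) set" where
  "arcs P = {(i, j). i < j \<and> {i, j} \<in> P}"

definition neighbor_alignment :: "nat \<times> nat \<Rightarrow> nat \<times> nat \<Rightarrow> bool" where
  "neighbor_alignment = (\<lambda>(i1, j1) (i2, j2). i1 < j1 \<and> j1 < i2 \<and> i2 < j2 \<and> j1 + 1 = i2)"

definition nesting :: "nat \<times> nat \<Rightarrow> nat \<times> nat \<Rightarrow> bool" where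
  "nesting = (\<lambda>(i1, j1) (i2, j2). i1 < i2 \<and> i2 < j2 \<and> j2 < j1)"

definition left_nesting :: "nat \<times> nat \<Rightarrow> nat \<times> nat \<Rightarrow> bool" where
  "left_nesting a b \<longleftrightarrow> nesting a b \<and> fst a + 1 = fst b"

definition right_nesting :: "nat \<times> nat \<Rightarrow> nat \<times> nat \<Rightarrow> bool" where
  "right_nesting a b \<longleftrightarrow> nesting a b \<and> snd b + 1 = snd a"

definition restricted_matchings :: "nat \<Rightarrow> nat \<Rightarrow> nat set set set" where
  "restricted_matchings m r = {P. partial_matching m P \<and> card (arcs P) = r \<and>
     (\<forall>a\<in>arcs P. \<forall>b\<in>arcs P.
        \<not> neighbor_alignment a b \<and> \<not> left_nesting a b \<and> \<not> right_nesting a b)}"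

definition compositions :: "nat \<Rightarrow> nat \<Rightarrow> nat list set" where
  "compositions a b = {cs. length cs = b \<and> sum_list cs = a}"

end

theory Submission
  imports Defs "HOL-Library.Product_Lexorder"
begin

text \<open>
  A matching of \<open>[2n-k-1]\<close> with \<open>n-k\<close> arcs has \<open>k-1\<close> singletons, which cut \<open>[2n-k-1]\<close> into
  \<open>k\<close> (possibly empty) sections. Without neighbor alignments, every section consists of arc
  openers followed by arc closers; without left and right nestings, the partners of the openers of
  a section increase, and so do those of the closers. Hence the matching is determined by the upper
  triangular \<open>k \<times> k\<close> matrix whose \<open>(i, j)\<close> entry counts the arcs from section \<open>i\<close> to
  section \<open>j\<close>, and every such matrix with entry sum \<open>n-k\<close> arises. For both directions a vertex
  is labelled by its section, its kind, the section of its partner and the index of its arc among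
  those joining the same two sections: the lexicographic order of the labels is the order of the
  vertices, and the set of labels depends only on the matrix.
\<close>

section \<open>Partial matchings as involutions\<close>

text \<open>\<open>p\<close> sends a vertex to its partner and a singleton to itself. Fixing
  everything outside \<open>{1..m}\<close> makes \<open>p\<close> a function determined by the
  matching.\<close>

locale involution =
  fixes m :: nat and p :: "nat \<Rightarrow> nat"
  assumes p_p [simp]: "p (p v) = v"
    and moved_in: "p v \<noteq> v \<Longrightarrow> v \<in> {1..m}"
begin

lemma p_eq_iff [simp]: "p u = p v \<longleftrightarrow> u = v"
  by (metis p_p)

lemma p_in_iff [simp]: "p v \<in> {1..m} \<longleftrightarrow> v \<in> {1..m}"
  by (metis moved_in p_p)

definition blocks :: "nat set set" where
  "blocks = (\<lambda>v. {v, p v}) ` {1..m}"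

definition openers :: "nat set" where
  "openers = {v. v < p v}"

definition closers :: "nat set" where
  "closers = {v. p v < v}"

definition singles :: "nat set" where
  "singles = {v \<in> {1..m}. p v = v}"

lemma pair_in_blocks_iff: "{v, w} \<in> blocks \<longleftrightarrow> v \<in> {1..m} \<and> w = p v"
proof
  assume "{v, w} \<in> blocks"
  then obtain x where x: "x \<in> {1..m}" "{v, w} = {x, p x}"
    by (auto simp: blocks_def)
  then have "v = x \<and> w = p x \<or> v = p x \<and> w = x"
    by (auto simp: doubleton_eq_iff)
  then show "v \<in> {1..m} \<and> w = p v"
    using x p_in_iff by auto
qed (auto simp: blocks_def)

lemma arcs_blocks: "arcs blocks = (\<lambda>v. (v, p v)) ` openers"
  using moved_in by (force simp: arcs_def pair_in_blocks_iff openers_def)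

lemma card_arcs_blocks: "card (arcs blocks) = card openers"
  unfolding arcs_blocks by (rule card_image) (auto simp: inj_on_def)

lemma partial_matching_blocks: "partial_matching m blocks"
  unfolding partial_matching_def
proof (intro conjI ballI)
  show "partition_on {1..m} blocks"
  proof (rule partition_onI)
    show "\<Union> blocks = {1..m}"
      unfolding blocks_def using p_in_iff by blast
    show "disjnt A B" if AB: "A \<in> blocks" "B \<in> blocks" "A \<noteq> B" for A B
    proof -
      obtain v w where vw: "A = {v, p v}" "B = {w, p w}"
        using AB by (auto simp: blocks_def)
      then have "w \<noteq> v" "w \<noteq> p v"
        using AB(3) by auto
      then show ?thesis
        using vw by (metis disjnt_insert1 disjnt_empty1 insertE p_p singletonD)
    qed
  qed (auto simp: blocks_def)
  show "card B \<le> 2" if "B \<in> blocks" for B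
    using that by (auto simp: blocks_def card_insert_if simp del: p_in_iff)
qed

lemma finite_openers: "finite openers"
  by (rule finite_subset[of _ "{1..m}"]) (use moved_in in \<open>force simp: openers_def\<close>, simp)

lemma finite_singles: "finite singles"
  by (simp add: singles_def)

text \<open>\<open>p\<close> maps the openers bijectively onto the closers, and
  \<open>{1..m}\<close> splits into singletons, openers and closers.\<close>

lemma card_singles: "card singles + 2 * card openers = m"
proof -
  have cl: "closers = p ` openers"
    by (auto simp: closers_def openers_def image_iff) (metis p_p)
  then have "card closers = card openers"
    by (metis card_image inj_onI p_eq_iff)
  moreover have "{1..m} = singles \<union> (openers \<union> closers)"
    using moved_in by (force simp: singles_def openers_def closers_def)
  moreover have "card (singles \<union> (openers \<union> closers)) = card singles + (card openers + card closers)"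
    by (subst card_Un_disjoint, use finite_openers finite_singles cl in
        \<open>auto simp: singles_def openers_def closers_def\<close>)
       (subst card_Un_disjoint, auto)
  ultimately show ?thesis
    by (metis card_atLeastAtMost diff_Suc_1 mult_2)
qed

end

lemma partial_matching_obtains_involution:
  assumes "partial_matching m P"
  obtains p where "involution m p" "P = involution.blocks m p"
proof -
  have part: "partition_on {1..m} P" and card2: "\<And>B. B \<in> P \<Longrightarrow> card B \<le> 2"
    using assms by (auto simp: partial_matching_def)
  \<comment> \<open>A singleton block is read as \<open>{v, v}\<close>, so \<open>w = v\<close> is
    allowed.\<close>
  have ex: "\<exists>w. {v, w} \<in> P" if v: "v \<in> {1..m}" for v
  proof -
    obtain B where B: "B \<in> P" "v \<in> B"
      using part v by (metis UnionE partition_onD1)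
    have "finite B"
      using B part finite_elements[of "{1..m}" P] by (metis finite_atLeastAtMost finite_subset Union_upper partition_onD1)
    then have "card (B - {v}) \<le> 1"
      using card2[OF B(1)] B(2) by simp
    then consider "B - {v} = {}" | w where "B - {v} = {w}"
      by (metis One_nat_def \<open>finite B\<close> card_0_eq card_1_singletonE finite_Diff le_Suc_eq le_zero_eq)
    then show ?thesis
      by cases (use B in \<open>metis Diff_eq_empty_iff insert_absorb2 singletonD subset_singletonD empty_iff\<close>,
          use B in \<open>metis insert_Diff\<close>)
  qed
  have uniq: "B = B'" if "B \<in> P" "B' \<in> P" "x \<in> B" "x \<in> B'" for B B' x
    using part that by (metis disjnt_iff pairwiseD partition_onD2 disjointD disjoint_iff)
  define p where "p v = (if v \<in> {1..m} then SOME w. {v, w} \<in> P else v)" for v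
  have p: "{v, p v} \<in> P" if "v \<in> {1..m}" for v
    using someI_ex[OF ex[OF that]] that by (simp add: p_def)
  have sub: "B \<subseteq> {1..m}" if "B \<in> P" for B
    using part that by (metis Union_upper partition_onD1)
  have inv: "involution m p"
  proof
    fix v
    show "v \<in> {1..m}" if "p v \<noteq> v"
      using that by (auto simp: p_def split: if_splits)
    show "p (p v) = v"
    proof (cases "v \<in> {1..m}")
      case True
      then have "p v \<in> {1..m}"
        using p sub by blast
      then have "{v, p v} = {p v, p (p v)}"
        using uniq[of "{v, p v}" "{p v, p (p v)}" "p v"] p True by blast
      then show ?thesis
        by (metis doubleton_eq_iff)
    qed (auto simp: p_def)
  qed
  have "P = (\<lambda>v. {v, p v}) ` {1..m}"
  proof (intro equalityI subsetI)
    fix B assume B: "B \<in> P"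
    then obtain v where v: "v \<in> B"
      using part by (metis equals0I partition_onD3)
    then have "v \<in> {1..m}" using B sub by blast
    moreover have "B = {v, p v}"
      using uniq[OF B p, of v v] v \<open>v \<in> {1..m}\<close> by simp
    ultimately show "B \<in> (\<lambda>v. {v, p v}) ` {1..m}" by blast
  qed (use p in auto)
  with inv that show thesis
    by (simp add: involution.blocks_def)
qed

text \<open>Each forbidden pattern is visible at two adjacent vertices: a closer followed by an
  opener, or two openers or two closers whose partners decrease.\<close>

locale restricted_involution = involution +
  assumes no_alignment: "p v < v \<Longrightarrow> \<not> Suc v < p (Suc v)"
    and no_left: "v < p v \<Longrightarrow> Suc v < p (Suc v) \<Longrightarrow> p v < p (Suc v)"
    and no_right: "p v < v \<Longrightarrow> p (Suc v) < Suc v \<Longrightarrow> p v < p (Suc v)"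

lemma (in involution) blocks_in_restricted_matchings_iff:
  "blocks \<in> restricted_matchings m r \<longleftrightarrow> restricted_involution m p \<and> card openers = r"
proof -
  have align: "(\<forall>a\<in>arcs blocks. \<forall>b\<in>arcs blocks. \<not> neighbor_alignment a b) \<longleftrightarrow>
      (\<forall>v. p v < v \<longrightarrow> \<not> Suc v < p (Suc v))"
    by (auto simp: arcs_blocks openers_def neighbor_alignment_def)
      (metis Suc_eq_plus1 p_p lessI)
  have left: "(\<forall>a\<in>arcs blocks. \<forall>b\<in>arcs blocks. \<not> left_nesting a b) \<longleftrightarrow>
      (\<forall>v. v < p v \<longrightarrow> Suc v < p (Suc v) \<longrightarrow> p v < p (Suc v))"
  proof -
    have "\<not> p (Suc v) < p v \<longleftrightarrow> p v < p (Suc v)" for v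
      by (metis linorder_neqE_nat n_not_Suc_n order_less_asym p_p)
    then show ?thesis
      by (auto simp: arcs_blocks openers_def left_nesting_def nesting_def)
  qed
  have right: "(\<forall>a\<in>arcs blocks. \<forall>b\<in>arcs blocks. \<not> right_nesting a b) \<longleftrightarrow>
      (\<forall>v. p v < v \<longrightarrow> p (Suc v) < Suc v \<longrightarrow> p v < p (Suc v))" (is "?L = ?R")
  proof
    assume L: ?L
    show ?R
    proof (intro allI impI)
      fix v assume v: "p v < v" "p (Suc v) < Suc v"
      have "(p v, v) \<in> arcs blocks" "(p (Suc v), Suc v) \<in> arcs blocks"
        using v by (force simp: arcs_blocks openers_def)+
      \<comment> \<open>The outer arc of a right nesting is the one ending at
        \<open>Suc v\<close>.\<close>
      then have "\<not> right_nesting (p (Suc v), Suc v) (p v, v)"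
        using L by blast
      then have "\<not> p (Suc v) < p v"
        using v by (simp add: right_nesting_def nesting_def)
      then show "p v < p (Suc v)"
        by (metis linorder_neqE_nat n_not_Suc_n p_p)
    qed
  next
    assume R: ?R
    show ?L
    proof (intro ballI notI)
      fix a b assume ab: "a \<in> arcs blocks" "b \<in> arcs blocks" "right_nesting a b"
      then obtain u v where uv: "a = (u, p u)" "b = (v, p v)" "u < p u" "v < p v"
        by (auto simp: arcs_blocks openers_def)
      \<comment> \<open>The adjacency is now at the right ends, so the arcs are renamed by their
        closers.\<close>
      define x y where "x = p u" and "y = p v"
      have xy: "a = (p x, x)" "b = (p y, y)" "p x < x" "p y < y"
        using uv by (simp_all add: x_def y_def)
      then have "x = Suc y" "p x < p y"
        using ab(3) by (auto simp: right_nesting_def nesting_def)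
      then show False
        using R xy by fastforce
    qed
  qed
  have "restricted_involution m p \<longleftrightarrow> (\<forall>v. p v < v \<longrightarrow> \<not> Suc v < p (Suc v)) \<and>
      (\<forall>v. v < p v \<longrightarrow> Suc v < p (Suc v) \<longrightarrow> p v < p (Suc v)) \<and>
      (\<forall>v. p v < v \<longrightarrow> p (Suc v) < Suc v \<longrightarrow> p v < p (Suc v))"
    using involution_axioms
    by (auto simp: restricted_involution_def restricted_involution_axioms_def)
  then show ?thesis
    using align left right
    by (auto simp: restricted_matchings_def partial_matching_blocks card_arcs_blocks)
qed

definition restricted_involutions :: "nat \<Rightarrow> nat \<Rightarrow> (nat \<Rightarrow> nat) set" where
  "restricted_involutions m r = {p. restricted_involution m p \<and> card (involution.openers p) = r}"

text \<open>Injectivity: the blocks determine the partner of each vertex in \<open>{1..m}\<close>,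
  and outside both functions are the identity.\<close>

lemma bij_betw_blocks:
  "bij_betw (involution.blocks m) (restricted_involutions m r) (restricted_matchings m r)"
  unfolding bij_betw_def
proof (intro conjI inj_onI equalityI subsetI)
  fix p q
  assume p: "p \<in> restricted_involutions m r" and q: "q \<in> restricted_involutions m r"
    and eq: "involution.blocks m p = involution.blocks m q"
  interpret P: involution m p
    using p by (auto simp: restricted_involutions_def restricted_involution_def)
  interpret Q: involution m q
    using q by (auto simp: restricted_involutions_def restricted_involution_def)
  show "p = q"
  proof
    fix v show "p v = q v"
      by (metis P.moved_in P.pair_in_blocks_iff Q.moved_in Q.pair_in_blocks_iff eq)
  qed
next
  fix P assume "P \<in> involution.blocks m ` restricted_involutions m r"
  then show "P \<in> restricted_matchings m r"
    by (auto simp: restricted_involutions_def restricted_involution_def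
        involution.blocks_in_restricted_matchings_iff)
next
  fix P assume P: "P \<in> restricted_matchings m r"
  then obtain p where "involution m p" "P = involution.blocks m p"
    by (auto simp: restricted_matchings_def elim: partial_matching_obtains_involution)
  then show "P \<in> involution.blocks m ` restricted_involutions m r"
    using P by (auto simp: restricted_involutions_def involution.blocks_in_restricted_matchings_iff)
qed

section \<open>Ranks in a finite linear order\<close>

text \<open>Counting with \<le> makes ranks start at 1, like the vertices.\<close>

definition rank :: "'a::linorder set \<Rightarrow> 'a \<Rightarrow> nat" where
  "rank V v = card {w \<in> V. w \<le> v}"

lemma rank_less_iff:
  assumes "finite V" "u \<in> V" "v \<in> V"
  shows "rank V u < rank V v \<longleftrightarrow> u < v"
proof -
  have "rank V a < rank V b" if "a < b" "b \<in> V" for a b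
  proof -
    have "{w \<in> V. w \<le> a} \<subset> {w \<in> V. w \<le> b}"
      using that by force
    then show ?thesis
      unfolding rank_def using assms(1) by (intro psubset_card_mono) auto
  qed
  then show ?thesis
    using assms by (metis linorder_neqE order_less_asym)
qed

lemma bij_betw_rank:
  assumes "finite V"
  shows "bij_betw (rank V) V {1..card V}"
proof -
  have inj: "inj_on (rank V) V"
    using rank_less_iff[OF assms] by (metis inj_onI linorder_neqE order_less_irrefl)
  have "rank V v \<in> {1..card V}" if "v \<in> V" for v
  proof -
    have "0 < rank V v"
      unfolding rank_def using assms that by (subst card_gt_0_iff) auto
    moreover have "rank V v \<le> card V"
      unfolding rank_def using assms by (intro card_mono) auto
    ultimately show ?thesis by simp
  qed
  then have "rank V ` V \<subseteq> {1..card V}" by blast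
  then have "rank V ` V = {1..card V}"
    by (simp add: card_image card_subset_eq inj)
  with inj show ?thesis
    by (simp add: bij_betw_def)
qed

text \<open>The elements up to \<open>f x\<close> are the images of \<open>1, ..., x\<close>. With
  \<open>f = label\<close> this recovers a vertex from its label.\<close>

lemma rank_image_strict_mono:
  assumes "strict_mono_on {1..m} f" "x \<in> {1..m}"
  shows "rank (f ` {1..m}) (f x) = x"
proof -
  have "{w \<in> f ` {1..m}. w \<le> f x} = f ` {1..x}"
    using assms by (auto simp: strict_mono_on_less_eq)
  moreover have "inj_on f {1..x}"
    using strict_mono_on_imp_inj_on[OF assms(1)] assms(2) by (auto intro: inj_on_subset)
  ultimately show ?thesis
    by (simp add: rank_def card_image)
qed

section \<open>From restricted involutions to matrices\<close>

context involution
begin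

text \<open>Sections are numbered from 0; by the strict inequality a singleton belongs to the
  section that it closes.\<close>

definition sec :: "nat \<Rightarrow> nat" where
  "sec v = card {s \<in> singles. s < v}"

definition entry :: "nat \<times> nat \<Rightarrow> nat" where
  "entry = (\<lambda>(i, j). card {v \<in> openers. sec v = i \<and> sec (p v) = j})"

text \<open>Meant for openers: a closer is labelled with the index of its opener, so both ends of an
  arc share it.\<close>

definition idx :: "nat \<Rightarrow> nat" where
  "idx v = card {w \<in> openers. sec w = sec v \<and> sec (p w) = sec (p v) \<and> w < v}"

text \<open>Kinds: 0 for openers, 1 for closers, 2 for singletons, which thus come last in their section.\<close>

definition label :: "nat \<Rightarrow> nat \<times> nat \<times> nat \<times> nat" where
  "label v = (if v < p v then (sec v, 0, sec (p v), idx v)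
              else if p v < v then (sec v, 1, sec (p v), idx (p v))
              else (sec v, 2, 0, 0))"

lemma sec_mono: "u \<le> v \<Longrightarrow> sec u \<le> sec v"
  unfolding sec_def using finite_singles by (intro card_mono) auto

lemma sec_less: "s \<in> singles \<Longrightarrow> s < v \<Longrightarrow> sec s < sec v"
  unfolding sec_def using finite_singles by (intro psubset_card_mono) auto

lemma sec_le: "sec v \<le> card singles"
  unfolding sec_def using finite_singles by (intro card_mono) auto

lemma idx_less_entry: "v < p v \<Longrightarrow> idx v < entry (sec v, sec (p v))"
  unfolding idx_def entry_def using finite_openers
  by (auto simp: openers_def intro!: psubset_card_mono)

lemma idx_less:
  assumes "u < v" "u < p u" "sec u = sec v" "sec (p u) = sec (p v)"
  shows "idx u < idx v"
  unfolding idx_def using finite_openers assms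
  by (auto simp: openers_def intro!: psubset_card_mono)

text \<open>A singleton at \<open>w\<close> would raise the section number before \<open>v\<close>.
  The bound \<open>w < v\<close> is strict because \<open>v\<close> may be the singleton closing the
  section.\<close>

lemma moved_between:
  assumes "sec u = sec v" "1 \<le> u" "v \<le> m" "u \<le> w" "w < v"
  shows "p w \<noteq> w"
proof
  assume "p w = w"
  then have "w \<in> singles"
    using assms by (auto simp: singles_def)
  then show False
    using sec_less[of w v] sec_mono[of u w] assms by auto
qed

end

section \<open>Labels increase along the vertices\<close>

context restricted_involution
begin

text \<open>Going up one vertex at a time, no singleton intervenes within the section and
  \<open>no_alignment\<close> forbids an opener right after a closer.\<close>

lemma closers_up:
  assumes "p u < u" "u \<le> v" "v \<le> m" "sec u = sec v" "p v \<noteq> v"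
  shows "p v < v"
  using assms(2,1,3-5)
proof (induction v rule: dec_induct)
  case (step v)
  have "sec v = sec u"
    using sec_mono[of u v] sec_mono[of v "Suc v"] step by simp
  moreover have "p v \<noteq> v"
    using moved_between[of u "Suc v" v] step by auto
  ultimately have "p v < v"
    using step by simp
  then show ?case
    using no_alignment[of v] step by (metis linorder_neqE_nat)
qed

text \<open>All vertices from \<open>u\<close> to \<open>v\<close> are closers by
  \<open>closers_up\<close>, so \<open>no_right\<close> can be chained along them.\<close>

lemma closers_mono:
  assumes "p u < u" "u < v" "p v < v" "sec u = sec v"
  shows "p u < p v"
proof -
  have "Suc u \<le> v" using assms by simp
  moreover have "v \<in> {1..m}" using assms moved_in[of v] by simp
  ultimately show ?thesis
    using assms(1,3,4)
  proof (induction v rule: dec_induct)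
    case base
    then show ?case using no_right by blast
  next
    case (step v)
    have s: "sec v = sec u"
      using sec_mono[of u v] sec_mono[of v "Suc v"] step by simp
    have "p v \<noteq> v"
      using moved_between[of u "Suc v" v] step by auto
    then have v: "p v < v"
      using closers_up[of u v] s step by auto
    have "v \<in> {1..m}" using v moved_in[of v] by simp
    then have "p u < p v"
      using step s v by simp
    also have "p v < p (Suc v)"
      using no_right v step by blast
    finally show ?case .
  qed
qed

lemma openers_mono:
  assumes "u < p u" "u < v" "v < p v" "sec u = sec v"
  shows "p u < p v"
proof -
  have "Suc u \<le> v" using assms by simp
  moreover have "v \<in> {1..m}" using assms moved_in[of v] by simp
  ultimately show ?thesis
    using assms(1,3,4)
  proof (induction v rule: dec_induct)
    case base
    then show ?case using no_left by blast
  next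
    case (step v)
    have s: "sec v = sec u"
      using sec_mono[of u v] sec_mono[of v "Suc v"] step by simp
    have u: "u \<in> {1..m}"
      using moved_in[of u] step by simp
    have "p v \<noteq> v"
      using moved_between[of u "Suc v" v] step u by auto
    \<comment> \<open>Here the kind of \<open>v\<close> is inferred from its successor, an opener,
      which cannot follow a closer.\<close>
    moreover have "\<not> p v < v"
      using no_alignment[of v] step by blast
    ultimately have v: "v < p v" by simp
    have "v \<in> {1..m}" using v moved_in[of v] by simp
    then have "p u < p v"
      using step s v by simp
    also have "p v < p (Suc v)"
      using no_left v step by blast
    finally show ?case .
  qed
qed

lemma label_strict_mono: "strict_mono_on {1..m} label"
proof (rule strict_mono_onI)
  fix u v assume uv: "u \<in> {1..m}" "v \<in> {1..m}" "u < v"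
  show "label u < label v"
  proof (cases "sec u = sec v")
    case False
    then have "sec u < sec v"
      using sec_mono[of u v] uv by simp
    then show ?thesis
      by (auto simp: label_def less_prod_def)
  next
    case True
    then have "p u \<noteq> u"
      using moved_between[of u v u] uv by auto
    \<comment> \<open>By \<open>closers_up\<close>, a closer is followed in its section only by
      closers and the closing singleton; the kinds 0, 1, 2 thus never decrease.\<close>
    then consider "u < p u" "v < p v" | "u < p u" "\<not> v < p v" | "p u < u" "p v < v" | "p u < u" "p v = v"
      using closers_up[of u v] uv True by (metis atLeastAtMost_iff linorder_neqE_nat less_imp_le)
    then show ?thesis
    proof cases
      case 1
      then have "p u < p v"
        using openers_mono uv True by blast
      then have "sec (p u) < sec (p v) \<or> sec (p u) = sec (p v)"
        using sec_mono[of "p u" "p v"] by linarith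
      then show ?thesis
        using 1 True idx_less[of u v] uv by (auto simp: label_def)
    next
      case 2
      then show ?thesis
        using True by (auto simp: label_def)
    next
      case 3
      then have less: "p u < p v"
        using closers_mono uv True by blast
      then have "sec (p u) < sec (p v) \<or> sec (p u) = sec (p v)"
        using sec_mono[of "p u" "p v"] by linarith
      then show ?thesis
        using 3 True less idx_less[of "p u" "p v"] by (auto simp: label_def)
    next
      case 4
      then show ?thesis
        using True by (auto simp: label_def)
    qed
  qed
qed

end

definition triangle :: "nat \<Rightarrow> (nat \<times> nat) set" where
  "triangle k = {(i, j). i \<le> j \<and> j < k}"

lemma finite_triangle: "finite (triangle k)"
  by (rule finite_subset[of _ "{..<k} \<times> {..<k}"]) (auto simp: triangle_def)

text \<open>Requiring zeros off the triangle makes such a function determined by its triangular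
  entries.\<close>

definition matrices :: "nat \<Rightarrow> nat \<Rightarrow> (nat \<times> nat \<Rightarrow> nat) set" where
  "matrices k r = {M. (\<forall>x. x \<notin> triangle k \<longrightarrow> M x = 0) \<and> sum M (triangle k) = r}"

text \<open>The entries are the fibre sizes of the map from openers to pairs of sections. It lands
  in the triangle because an opener precedes its partner.\<close>

lemma (in involution) entry_in_matrices:
  assumes "card singles < k"
  shows "entry \<in> matrices k (card openers)"
proof -
  let ?f = "\<lambda>v. (sec v, sec (p v))"
  have img: "?f ` openers \<subseteq> triangle k"
    using sec_le assms by (auto simp: triangle_def openers_def intro: sec_mono le_less_trans)
  have eq: "entry x = card {v \<in> openers. ?f v = x}" for x
    by (cases x) (auto simp: entry_def intro: arg_cong[where f = card])
  have "entry x = 0" if "x \<notin> triangle k" for x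
    using img that by (auto simp: eq finite_openers)
  moreover have "sum entry (triangle k) = card openers"
    using sum_fun_comp[OF finite_openers finite_triangle img, of "\<lambda>_. 1::nat"]
    by (simp add: eq)
  ultimately show ?thesis
    by (simp add: matrices_def)
qed

section \<open>The labels prescribed by a matrix\<close>

text \<open>The three sets describe openers, closers and singletons, always with the own section
  first. The last section has no closing singleton, hence \<open>k - 1\<close>.\<close>

definition labels :: "nat \<Rightarrow> (nat \<times> nat \<Rightarrow> nat) \<Rightarrow> (nat \<times> nat \<times> nat \<times> nat) set" where
  "labels k M = {(i, 0, j, t) | i j t. (i, j) \<in> triangle k \<and> t < M (i, j)}
    \<union> {(j, 1, i, t) | i j t. (i, j) \<in> triangle k \<and> t < M (i, j)}
    \<union> {(i, 2, 0, 0) | i. i < k - 1}"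

fun mate :: "nat \<times> nat \<times> nat \<times> nat \<Rightarrow> nat \<times> nat \<times> nat \<times> nat" where
  "mate (i, c, j, t) = (if c = 0 then (j, 1, i, t) else if c = 1 then (j, 0, i, t) else (i, c, j, t))"

lemma mate_mate [simp]: "mate (mate v) = v"
  by (cases v) auto

lemma mate_in_labels_iff: "mate v \<in> labels k M \<longleftrightarrow> v \<in> labels k M"
  by (cases v) (auto simp: labels_def)

lemma
  shows finite_labels: "finite (labels k M)"
    and card_labels: "card (labels k M) = 2 * sum M (triangle k) + (k - 1)"
proof -
  \<comment> \<open>\<open>?S\<close> indexes the arcs, and each arc yields one opener label and one
    closer label.\<close>
  let ?S = "SIGMA x:triangle k. {..<M x}"
  let ?f = "\<lambda>((i, j), t). (i, 0::nat, j, t)" and ?g = "\<lambda>((i, j), t). (j, 1::nat, i, t)"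
    and ?h = "\<lambda>i. (i, 2::nat, 0::nat, 0::nat)"
  have eq: "labels k M = ?f ` ?S \<union> ?g ` ?S \<union> ?h ` {..<k - 1}"
  proof -
    have "?f ` ?S = {(i, 0, j, t) | i j t. (i, j) \<in> triangle k \<and> t < M (i, j)}"
      by force
    moreover have "?g ` ?S = {(j, 1, i, t) | i j t. (i, j) \<in> triangle k \<and> t < M (i, j)}"
      by force
    moreover have "?h ` {..<k - 1} = {(i, 2, 0, 0) | i. i < k - 1}"
      by auto
    ultimately show ?thesis
      by (simp only: labels_def)
  qed
  have fin: "finite ?S"
    using finite_triangle by auto
  then show "finite (labels k M)"
    by (simp add: eq)
  have c: "card ?S = sum M (triangle k)"
    using finite_triangle by simp
  have "card (?f ` ?S) = card ?S" "card (?g ` ?S) = card ?S" "card (?h ` {..<k - 1}) = k - 1"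
    by (auto intro!: card_image simp: inj_on_def card_image)
  moreover have "card (labels k M) = card (?f ` ?S) + card (?g ` ?S) + card (?h ` {..<k - 1})"
    unfolding eq by (subst card_Un_disjoint; (use fin in auto)?)+
  ultimately show "card (labels k M) = 2 * sum M (triangle k) + (k - 1)"
    by (simp only: c)
qed

context restricted_involution
begin

lemma label_p: "label (p v) = mate (label v)"
  by (auto simp: label_def)

text \<open>One inclusion suffices: \<open>label\<close> is injective, and both sides have as many
  elements as there are vertices.\<close>

lemma label_image:
  assumes "card singles + 1 = k"
  shows "label ` {1..m} = labels k entry"
proof (rule card_subset_eq[OF finite_labels])
  show "label ` {1..m} \<subseteq> labels k entry"
  proof (intro image_subsetI)
    fix v assume v: "v \<in> {1..m}"
    have lt: "sec w < k" for w
      using sec_le[of w] assms by simp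
    show "label v \<in> labels k entry"
    proof (cases "p v" v rule: linorder_cases)
      case less
      then show ?thesis
        using idx_less_entry[of "p v"] lt sec_mono[of "p v" v]
        by (auto simp: label_def labels_def triangle_def)
    next
      case greater
      then show ?thesis
        using idx_less_entry[of v] lt sec_mono[of v "p v"]
        by (auto simp: label_def labels_def triangle_def)
    next
      case equal
      then have s: "v \<in> singles"
        using v by (simp add: singles_def)
      \<comment> \<open>The singleton \<open>v\<close> is not counted in its own section
        number.\<close>
      then have "sec v < card singles"
        unfolding sec_def using finite_singles by (intro psubset_card_mono) auto
      then show ?thesis
        using equal assms by (auto simp: label_def labels_def)
    qed
  qed
  have "card (label ` {1..m}) = m"
    using strict_mono_on_imp_inj_on[OF label_strict_mono] by (simp add: card_image)
  moreover have "sum entry (triangle k) = card openers"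
    using entry_in_matrices[of k] assms by (simp add: matrices_def)
  ultimately show "card (label ` {1..m}) = card (labels k entry)"
    using card_singles assms by (simp add: card_labels)
qed

end

section \<open>From matrices to restricted involutions\<close>

text \<open>This is \<open>mate\<close> transported from labels to vertices by \<open>rank\<close>,
  and the identity elsewhere, as the locale \<open>involution\<close> demands.\<close>

definition involution_of :: "nat \<Rightarrow> (nat \<times> nat \<Rightarrow> nat) \<Rightarrow> nat \<Rightarrow> nat" where
  "involution_of k M x =
    (if x \<in> rank (labels k M) ` labels k M
     then rank (labels k M) (mate (inv_into (labels k M) (rank (labels k M)) x)) else x)"

locale labelling =
  fixes k :: nat and M :: "nat \<times> nat \<Rightarrow> nat" and m :: nat
  assumes m: "m = card (labels k M)"
begin

abbreviation "V \<equiv> labels k M"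
abbreviation "\<phi> \<equiv> rank V"
abbreviation "p \<equiv> involution_of k M"

lemma bij_phi: "bij_betw \<phi> V {1..m}"
  using bij_betw_rank[OF finite_labels] by (simp add: m)

lemma phi_less_iff [simp]: "u \<in> V \<Longrightarrow> v \<in> V \<Longrightarrow> \<phi> u < \<phi> v \<longleftrightarrow> u < v"
  by (rule rank_less_iff[OF finite_labels])

lemma phi_eq_iff [simp]: "u \<in> V \<Longrightarrow> v \<in> V \<Longrightarrow> \<phi> u = \<phi> v \<longleftrightarrow> u = v"
  using bij_phi by (auto simp: bij_betw_def inj_on_def)

lemma phi_surj: "x \<in> {1..m} \<Longrightarrow> \<exists>v\<in>V. x = \<phi> v"
  using bij_phi by (auto simp: bij_betw_def)

lemma p_phi [simp]: "v \<in> V \<Longrightarrow> p (\<phi> v) = \<phi> (mate v)"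
  using bij_phi by (auto simp: involution_of_def bij_betw_def)

lemma p_outside: "x \<notin> {1..m} \<Longrightarrow> p x = x"
  using bij_phi by (auto simp: involution_of_def bij_betw_def)

lemma mate_in [simp]: "v \<in> V \<Longrightarrow> mate v \<in> V"
  by (simp add: mate_in_labels_iff)

sublocale involution m p
proof
  fix x
  show "x \<in> {1..m}" if "p x \<noteq> x"
    using that p_outside by blast
  show "p (p x) = x"
  proof (cases "x \<in> {1..m}")
    case True
    then obtain v where "v \<in> V" "x = \<phi> v"
      using phi_surj by blast
    then show ?thesis by simp
  qed (simp add: p_outside)
qed

lemma no_label_between:
  assumes "Suc (\<phi> u) = \<phi> v" "u \<in> V" "v \<in> V" "w \<in> V"
  shows "\<not> (u < w \<and> w < v)"
  using assms phi_less_iff[of u w] phi_less_iff[of w v] by linarith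

text \<open>The singleton closing a section separates its labels from those of later sections.\<close>

lemma same_section:
  assumes "Suc (\<phi> u) = \<phi> v" "u \<in> V" "v \<in> V" "mate u \<noteq> u"
  shows "fst u = fst v"
proof (rule ccontr)
  assume neq: "fst u \<noteq> fst v"
  have "u < v"
    using assms phi_less_iff[of u v] by linarith
  with neq have "fst u < fst v"
    by (auto simp: less_prod_def)
  moreover have "fst v < k"
    using assms(3) by (auto simp: labels_def triangle_def)
  ultimately have "(fst u, 2, 0, 0) \<in> V" "(fst u, 2, 0, 0) < v"
    by (auto simp: labels_def less_prod_def)
  moreover have "u < (fst u, 2, 0, 0)"
    using assms by (auto simp: labels_def)
  ultimately show False
    using no_label_between assms by blast
qed

text \<open>An arc never goes to an earlier section, and within one section kind 0 precedes kind
  1.\<close>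

lemma less_mate_iff: "u \<in> V \<Longrightarrow> u < mate u \<longleftrightarrow> fst (snd u) = 0"
  by (auto simp: labels_def triangle_def)

lemma mate_less_iff: "u \<in> V \<Longrightarrow> mate u < u \<longleftrightarrow> fst (snd u) = 1"
  by (auto simp: labels_def triangle_def)

sublocale restricted_involution m p
proof
  fix x
  have ex: "\<exists>u v. u \<in> V \<and> v \<in> V \<and> x = \<phi> u \<and> Suc x = \<phi> v \<and> mate u \<noteq> u \<and> fst u = fst v \<and> u < v"
    if moved: "p x \<noteq> x" "p (Suc x) \<noteq> Suc x"
  proof -
    obtain u v where uv: "u \<in> V" "v \<in> V" "x = \<phi> u" "Suc x = \<phi> v"
      using phi_surj[OF moved_in[OF moved(1)]] phi_surj[OF moved_in[OF moved(2)]] by blast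
    have "\<phi> u < \<phi> v"
      using uv(3,4) by simp
    then have "mate u \<noteq> u" "u < v"
      using uv moved(1) by auto
    with uv show ?thesis
      using same_section[of u v] by metis
  qed
  show "\<not> Suc x < p (Suc x)" if "p x < x"
  proof
    assume "Suc x < p (Suc x)"
    with that ex obtain u v where uv: "u \<in> V" "v \<in> V" "x = \<phi> u" "Suc x = \<phi> v" "fst u = fst v" "u < v"
      by (metis nat_neq_iff)
    then have "fst (snd u) = 1" "fst (snd v) = 0"
      using that \<open>Suc x < p (Suc x)\<close> by (simp_all add: less_mate_iff mate_less_iff)
    \<comment> \<open>In one section a label of kind 1 cannot lie below one of kind 0.\<close>
    then show False
      using uv by (cases u; cases v) auto
  qed
  show "p x < p (Suc x)" if "x < p x" "Suc x < p (Suc x)"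
  proof -
    from that ex obtain u v where uv: "u \<in> V" "v \<in> V" "x = \<phi> u" "Suc x = \<phi> v" "fst u = fst v" "u < v"
      by (metis nat_neq_iff)
    then have "fst (snd u) = 0" "fst (snd v) = 0"
      using that by (auto simp: less_mate_iff)
    \<comment> \<open>As section and kind agree, \<open>u < v\<close> compares partner section and
      index. After \<open>mate\<close> the partner section comes first and the equal own sections do
      not affect the order.\<close>
    then have "mate u < mate v"
      using uv by (cases u; cases v) auto
    then show ?thesis
      using uv by simp
  qed
  show "p x < p (Suc x)" if "p x < x" "p (Suc x) < Suc x"
  proof -
    from that ex obtain u v where uv: "u \<in> V" "v \<in> V" "x = \<phi> u" "Suc x = \<phi> v" "fst u = fst v" "u < v"
      by (metis nat_neq_iff)
    then have "fst (snd u) = 1" "fst (snd v) = 1"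
      using that by (auto simp: mate_less_iff)
    then have "mate u < mate v"
      using uv by (cases u; cases v) auto
    then show ?thesis
      using uv by simp
  qed
qed

section \<open>Recovering singletons, sections and matrix from the labels\<close>

lemma singles_eq: "singles = \<phi> ` (\<lambda>i. (i, 2, 0, 0)) ` {..<k - 1}"
proof (intro equalityI subsetI)
  fix x assume "x \<in> singles"
  then obtain v where v: "v \<in> V" "x = \<phi> v" "p x = x"
    using phi_surj[of x] unfolding singles_def by blast
  then have "mate v = v" by simp
  with v have "v \<in> (\<lambda>i. (i, 2, 0, 0)) ` {..<k - 1}"
    by (auto simp: labels_def)
  with v  show "x \<in> \<phi> ` (\<lambda>i. (i, 2, 0, 0)) ` {..<k - 1}"
    by blast
next
  fix x assume "x \<in> \<phi> ` (\<lambda>i. (i, 2, 0, 0)) ` {..<k - 1}"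
  then obtain i where i: "(i, 2, 0, 0) \<in> V" "x = \<phi> (i, 2, 0, 0)"
    by (auto simp: labels_def)
  then show "x \<in> singles"
    using bij_betwE[OF bij_phi] by (auto simp: singles_def)
qed

lemma card_singles_eq: "card singles = k - 1"
proof -
  have "(i, 2, 0, 0) \<in> V" if "i < k - 1" for i
    using that by (simp add: labels_def)
  then have "inj_on (\<lambda>i. \<phi> (i, 2, 0, 0)) {..<k - 1}"
    by (auto simp: inj_on_def)
  then show ?thesis
    by (simp add: singles_eq image_image card_image)
qed

text \<open>Kind 2 is last in its section, so the singleton labels below \<open>v\<close> are
  exactly those of the earlier sections.\<close>

lemma sec_phi:
  assumes "v \<in> V"
  shows "sec (\<phi> v) = fst v"
proof -
  have le: "fst v \<le> k - 1"
    using assms by (auto simp: labels_def triangle_def)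
  have in_V: "(i, 2, 0, 0) \<in> V" if "i < k - 1" for i
    using that by (simp add: labels_def)
  have "(i, 2, 0, 0) < v \<longleftrightarrow> i < fst v" for i
    using assms by (auto simp: labels_def less_prod_def)
  then have "{s \<in> singles. s < \<phi> v} = \<phi> ` (\<lambda>i. (i, 2, 0, 0)) ` {..<fst v}"
    using le in_V assms by (force simp: singles_eq)
  moreover have "inj_on (\<lambda>i. \<phi> (i, 2, 0, 0)) {..<fst v}"
    using in_V le by (auto simp: inj_on_def)
  ultimately show ?thesis
    by (simp add: sec_def image_image card_image)
qed

text \<open>The openers counted by an entry are the ranks of the labels \<open>(i, 0, j, t)\<close>
  with \<open>t < M (i, j)\<close>. Off the triangle there are no such labels, which is why
  \<open>M\<close> has to vanish there.\<close>

lemma entry_eq: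
  assumes "\<And>x. x \<notin> triangle k \<Longrightarrow> M x = 0"
  shows "entry = M"
proof
  fix x :: "nat \<times> nat"
  obtain i j where x: "x = (i, j)" by fastforce
  have "{v \<in> openers. sec v = i \<and> sec (p v) = j} = (\<lambda>t. \<phi> (i, 0, j, t)) ` {..<M (i, j)}"
  proof (intro equalityI subsetI)
    fix y assume y: "y \<in> {v \<in> openers. sec v = i \<and> sec (p v) = j}"
    then have "y < p y" by (simp add: openers_def)
    then obtain v where v: "v \<in> V" "y = \<phi> v"
      using phi_surj[OF moved_in[of y]] by auto
    then have "fst (snd v) = 0" "fst v = i" "fst (mate v) = j"
      using y \<open>y < p y\<close> sec_phi by (auto simp: less_mate_iff)
    then show "y \<in> (\<lambda>t. \<phi> (i, 0, j, t)) ` {..<M (i, j)}"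
      using v by (auto simp: labels_def)
  next
    fix y assume "y \<in> (\<lambda>t. \<phi> (i, 0, j, t)) ` {..<M (i, j)}"
    then obtain t where t: "t < M (i, j)" "y = \<phi> (i, 0, j, t)" by auto
    then have v: "(i, 0, j, t) \<in> V"
      using assms[of "(i, j)"] by (force simp: labels_def)
    then have "mate (i, 0, j, t) \<in> V"
      by (rule mate_in)
    then show "y \<in> {v \<in> openers. sec v = i \<and> sec (p v) = j}"
      using t v less_mate_iff[OF v] sec_phi[OF v] sec_phi[of "mate (i, 0, j, t)"]
      by (simp add: openers_def)
  qed
  moreover have "inj_on (\<lambda>t. \<phi> (i, 0, j, t)) {..<M (i, j)}"
  proof (rule inj_onI)
    fix s t assume st: "s \<in> {..<M (i, j)}" "t \<in> {..<M (i, j)}" "\<phi> (i, 0, j, s) = \<phi> (i, 0, j, t)"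
    then have "(i, 0, j, s) \<in> V" "(i, 0, j, t) \<in> V"
      using assms[of "(i, j)"] by (force simp: labels_def)+
    then show "s = t"
      using st by simp
  qed
  ultimately show "entry x = M x"
    by (simp add: x entry_def card_image)
qed

end

text \<open>The label of \<open>v\<close> has rank \<open>v\<close>, and \<open>label\<close> turns
  \<open>p\<close> into \<open>mate\<close>; hence transporting \<open>mate\<close> back by
  \<open>rank\<close> gives \<open>p\<close>.\<close>

lemma (in restricted_involution) involution_of_entry:
  assumes "card singles + 1 = k"
  shows "involution_of k entry = p"
proof
  fix x
  interpret L: labelling k entry m
    using label_image[OF assms] strict_mono_on_imp_inj_on[OF label_strict_mono]
    by unfold_locales (metis card_atLeastAtMost card_image diff_Suc_1)
  have rank_label: "rank (labels k entry) (label v) = v" if "v \<in> {1..m}" for v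
    using rank_image_strict_mono[OF label_strict_mono that] label_image[OF assms] by simp
  show "involution_of k entry x = p x"
  proof (cases "x \<in> {1..m}")
    case True
    then have "label x \<in> labels k entry"
      using label_image[OF assms] by blast
    then have "involution_of k entry x = rank (labels k entry) (label (p x))"
      using L.p_phi[of "label x"] rank_label[OF True] by (simp add: label_p)
    then show ?thesis
      using rank_label[of "p x"] p_in_iff[of x] True by metis
  next
    case False
    then show ?thesis
      using L.p_outside moved_in by metis
  qed
qed

lemma bij_betw_involution_of:
  assumes "1 \<le> k"
  shows "bij_betw (involution_of k) (matrices k r) (restricted_involutions (2 * r + k - 1) r)"
proof (rule bij_betw_byWitness[where f' = "involution.entry (2 * r + k - 1)"])
  let ?m = "2 * r + k - 1"
  have lab: "labelling k M ?m" if "M \<in> matrices k r" for M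
    using that assms by unfold_locales (auto simp: matrices_def card_labels)
  \<comment> \<open>Of the \<open>2 * r + k - 1\<close> vertices, \<open>2 * r\<close> are ends of
    arcs.\<close>
  have singles_count: "card (involution.singles ?m p) + 1 = k"
    if "p \<in> restricted_involutions ?m r" for p
    using that involution.card_singles[of ?m p] assms
    by (auto simp: restricted_involutions_def restricted_involution_def)
  have entry: "involution.entry ?m (involution_of k M) = M" if "M \<in> matrices k r" for M
    using that by (intro labelling.entry_eq[OF lab[OF that]]) (auto simp: matrices_def)
  then show "\<forall>M\<in>matrices k r. involution.entry ?m (involution_of k M) = M"
    by blast
  show "\<forall>p\<in>restricted_involutions ?m r. involution_of k (involution.entry ?m p) = p"
    using singles_count
    by (auto simp: restricted_involutions_def intro!: restricted_involution.involution_of_entry)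
  show "involution.entry ?m ` restricted_involutions ?m r \<subseteq> matrices k r"
  proof (intro image_subsetI)
    fix p assume p: "p \<in> restricted_involutions ?m r"
    then interpret restricted_involution ?m p
      by (simp add: restricted_involutions_def)
    show "entry \<in> matrices k r"
      using entry_in_matrices[of k] singles_count[OF p] p by (simp add: restricted_involutions_def)
  qed
  show "involution_of k ` matrices k r \<subseteq> restricted_involutions ?m r"
  proof (intro image_subsetI)
    fix M assume M: "M \<in> matrices k r"
    interpret labelling k M ?m
      by (rule lab[OF M])
    have "card openers = r"
      using card_singles card_singles_eq assms by simp
    then show "p \<in> restricted_involutions ?m r"
      using restricted_involution_axioms by (simp add: restricted_involutions_def)
  qed
qed

section \<open>Matrices as compositions\<close>

text \<open>Passing from \<open>k\<close> to \<open>Suc k\<close> adds a column with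
  \<open>k + 1\<close> entries.\<close>

lemma card_triangle: "card (triangle k) = (k + 1) choose 2"
proof (induction k)
  case (Suc k)
  have "triangle (Suc k) = triangle k \<union> (\<lambda>i. (i, k)) ` {..k}"
    by (auto simp: triangle_def)
  moreover have "triangle k \<inter> (\<lambda>i. (i, k)) ` {..k} = {}"
    by (auto simp: triangle_def)
  then have "card (triangle k \<union> (\<lambda>i. (i, k)) ` {..k}) = card (triangle k) + Suc k"
    by (simp add: card_Un_disjoint finite_triangle card_image inj_on_def)
  ultimately show ?case
    using Suc by (simp add: numeral_2_eq_2)
qed (simp add: triangle_def)

lemma bij_betw_matrices_compositions:
  "\<exists>f. bij_betw f (matrices k r) (compositions r (card (triangle k)))"
proof -
  let ?T = "triangle k"
  \<comment> \<open>Any enumeration of the triangle will do; a composition lists the entries in this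
    order.\<close>
  obtain e where e: "bij_betw e {..<card ?T} ?T"
    using ex_bij_betw_nat_finite[OF finite_triangle] by (auto simp: atLeast0LessThan)
  define d where "d = inv_into {..<card ?T} e"
  have d: "d x < card ?T" "e (d x) = x" if "x \<in> ?T" for x
    using e that bij_betw_inv_into_right[OF e that] bij_betwE[OF bij_betw_inv_into[OF e]]
    by (auto simp: d_def)
  have de: "d (e i) = i" "e i \<in> ?T" if "i < card ?T" for i
    using e that bij_betw_inv_into_left[OF e] bij_betwE[OF e] by (auto simp: d_def)
  define F where "F M = map (\<lambda>i. M (e i)) [0..<card ?T]" for M :: "nat \<times> nat \<Rightarrow> nat"
  define G where "G cs x = (if x \<in> ?T then cs ! d x else 0)" for cs :: "nat list" and x
  have sum_F: "sum_list (F M) = sum M ?T" for M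
    using sum.reindex_bij_betw[OF e, of M]
    by (simp add: F_def sum_list_sum_nth atLeast0LessThan)
  have FG: "F (G cs) = cs" if "length cs = card ?T" for cs
    using that by (intro nth_equalityI) (auto simp: F_def G_def de)
  have "bij_betw F (matrices k r) (compositions r (card ?T))"
  proof (rule bij_betw_byWitness[where f' = G])
    show "\<forall>M\<in>matrices k r. G (F M) = M"
      by (auto simp: matrices_def G_def F_def fun_eq_iff d)
    show "\<forall>cs\<in>compositions r (card ?T). F (G cs) = cs"
      by (simp add: compositions_def FG)
    show "F ` matrices k r \<subseteq> compositions r (card ?T)"
      by (auto simp: matrices_def compositions_def sum_F) (simp add: F_def)
    show "G ` compositions r (card ?T) \<subseteq> matrices k r"
      using sum_F FG by (auto simp: matrices_def compositions_def) (simp add: G_def, metis)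
  qed
  then show ?thesis by blast
qed

theorem theorem4p1:
  fixes n k :: nat
  assumes "1 \<le> k" and "k \<le> n"
  shows "\<exists>f. bij_betw f (restricted_matchings (2 * n - k - 1) (n - k))
                       (compositions (n - k) ((k + 1) choose 2))"
proof -
  \<comment> \<open>With \<open>r = n - k\<close> arcs this is the vertex count for which exactly
    \<open>k - 1\<close> singletons remain.\<close>
  have m: "2 * n - k - 1 = 2 * (n - k) + k - 1"
    using assms by simp
  obtain f where "bij_betw f (matrices k (n - k)) (compositions (n - k) ((k + 1) choose 2))"
    using bij_betw_matrices_compositions card_triangle by metis
  moreover have "bij_betw (involution.blocks (2 * n - k - 1) \<circ> involution_of k)
      (matrices k (n - k)) (restricted_matchings (2 * n - k - 1) (n - k))"
    using bij_betw_trans[OF bij_betw_involution_of[OF assms(1)] bij_betw_blocks] unfolding m .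
  ultimately show ?thesis
    using bij_betw_trans bij_betw_inv_into by blast
qed

end
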